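(* Let $\alpha\in(0,2/L_x)$ be a constant scalar, $r=\max(|1-\alpha L_x|,|1-\alpha\sigma|)$, and let $x_t$ be generated from an initial point $x_1\in\mathbb{R}^{n_x}$ by $x_{t+1}=\mathbf{prox}_{h,\alpha}(x_t-\alpha\,\eta_t(x_t))$, $t\ge1$. Suppose there is a positive scalar $G$ such that $\|\nabla F_t(x)\|\le G$ for all $t$ and all $x\in\mathcal{X}$. Let $\mathrm{Reg}_T^{\mathrm{Tracking}}=\sum_{t=1}^T\left(F_t(x_t)-F_t(x_t^* )\right)$ and $\mathrm{Reg}_T^{\mathrm{Estimation}}=\sum_{t=1}^T\left(F_t(x_{t+1})-F_t(x_t^* )\right)$ denote the tracking and estimation dynamic regrets. Then $$\mathrm{Reg}_T^{\mathrm{Tracking}}\le\frac{G}{1-r}\left[(e_1-re_T-\alpha\|\epsilon_T\|)+\alpha E_T+V_T\right]$$ and $$\mathrm{Reg}_T^{\mathrm{Estimation}}\le\frac{G}{1-r}\left[(\bar e_1-r\bar e_T-\alpha\|\epsilon_1\|)+\alpha E_T+rV_T\right],$$ where $e_t=\|x_t-x_t^*\|$, $\bar e_t=\|x_{t+1}-x_t^*\|$, $\epsilon_t=\nabla F_t(x_t)-\eta_t(x_t)$, $V_T=\sum_{t=1}^{T-1}\|x_{t+1}^*-x_t^*\|$ and $E_T=\sum_{t=1}^T\|\epsilon_t\|$.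
   Context: Setting. $n_x,n_w,m,q,T$ are positive integers; $\|\cdot\|$ is the Euclidean norm on $\mathbb{R}^{n_x}$ and a fixed norm on $\mathbb{R}^{n_w}$. $\mathcal{X}\subseteq\mathbb{R}^{n_x}$ is closed and convex. $\Xi\subseteq\mathbb{R}^{n_w}$, and $\mathbb{P}_t$ are probability distributions on $\Xi$ with finite first moment. $\mathfrak{W}(\mathbb{P},\mathbb{Q})=\inf_\Pi\int\|\xi_1-\xi_2\|\,\Pi(\mathrm{d}\xi_1,\mathrm{d}\xi_2)$ (infimum over joint distributions $\Pi$ with marginals $\mathbb{P},\mathbb{Q}$) is the Wasserstein distance. The time index ranges over the integers $\ge2-q$, so that the windows of $q$ time steps below are defined for every $t\ge1$. $f:\mathbb{R}^{n_x}\times\Xi\to\mathbb{R}$ and $F_t(x)=\mathbb{E}^{w\sim\mathbb{P}_t}\{f(x,w)\}$. Assumptions on $f$ and $\mathbb{P}_t$ (with constants $L_x,L_w,\sigma>0$, $\rho\ge0$): (a) $f(x,w)$ is twice continuously differentiable in $x$; (b) $f$, $\partial f/\partial x_i$, $\partial^2 f/\partial x_i\partial x_j$ are integrable with respect to $w$ for all $i,j$; (c) $\mathbb{E}^{w\sim\mathbb{P}_t}\{|f(x,w)|\}$, $\mathbb{E}^{w\sim\mathbb{P}_t}\{|\partial f(x,w)/\partial x_i|\}$, $\mathbb{E}^{w\sim\mathbb{P}_t}\{|\partial^2 f(x,w)/\partial x_i\partial x_j|\}$ are bounded for all $i,j,t$; (d) $\mathfrak{W}(\mathbb{P}_{t+1},\mathbb{P}_t)\le\rho$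 for all $t$; (e) $\|\nabla_xf(x,w)-\nabla_xf(x',w)\|\le L_x\|x-x'\|$ for all $x,x',w$; (f) $|\partial f(x,w)/\partial x_i-\partial f(x,w')/\partial x_i|\le L_w\|w-w'\|$ for all $x,w,w'$ and all $i$; (g) $\nabla_x^2f(x,w)\succeq\sigma I$ for all $x,w$. Light tails: there is a constant $a>1$ with $\mathbb{E}^{w\sim\mathbb{P}_k}\{\exp(\|w\|^a)\}<\infty$ for all $k$. Samples: at each time $k$ one observes $m$ realizations $w_k^{(1)},\dots,w_k^{(m)}$ of a random variable distributed according to $\mathbb{P}_k$, and $\eta_t(x)=\frac1{mq}\sum_{k=t-q+1}^t\sum_{i=1}^m\nabla_xf(x,w_k^{(i)})$. $h:\mathbb{R}^{n_x}\to\mathbb{R}\cup\{+\infty\}$ is closed and proper, and the iteration is applied to the time-varying problem $\min_{x\in\mathbb{R}^{n_x}}F_t(x)+h(x)$ (for $h$ the indicator function of $\mathcal{X}$, equal to $0$ on $\mathcal{X}$ and $+\infty$ elsewhere, this is $\min_{x\in\mathcal{X}}F_t(x)$); $\mathbf{prox}_{h,\alpha}(u)=\arg\min_{x\in\mathbb{R}^{n_x}}\left(h(x)+\frac1{2\alpha}\|x-u\|^2\right)$; $x_t^*=\arg\min_{x\in\mathcal{X}}F_t(x)$.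
   Formalization: The formal statement takes h to be the indicator function of X (the claim fails for general closed proper h, e.g. h=|x|), and proves the tracking bound only for x_1 in X (it fails for x_1 outside X, where the gradient is not bounded by G); the estimation bound allows any x_1. *)

theory Defs
  imports "HOL-Probability.Probability"
begin

text \<open>The gradient of a real-valued function as a vector; meaningful wherever the function is
  (Frechet) differentiable. Its components are the partial derivatives.\<close>

definition grad :: "(real^'n \<Rightarrow> real) \<Rightarrow> real^'n \<Rightarrow> real^'n" where
  "grad g x = (THE D. GDERIV g x :> D)"

text \<open>The entry \<open>hessian g x $ i $ j\<close> is the partial derivative in direction \<open>j\<close> of the partial
  derivative of \<open>g\<close> in direction \<open>i\<close>.\<close>

definition hessian :: "(real^'n \<Rightarrow> real) \<Rightarrow> real^'n \<Rightarrow> real^'n^'n" where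
  "hessian g x = jacobian (grad g) (at x)"

definition twice_cont_diff :: "(real^'n \<Rightarrow> real) \<Rightarrow> bool" where
  "twice_cont_diff g \<longleftrightarrow>
     (\<forall>x. g differentiable (at x)) \<and>
     (\<forall>x. grad g differentiable (at x)) \<and>
     continuous_on UNIV (hessian g)"

text \<open>The order on (symmetric) matrices given by positive semidefiniteness of the difference.
  It is only applied to Hessians of twice continuously differentiable functions, for which
  symmetry is automatic.\<close>

definition loewner_le :: "real^'n^'n \<Rightarrow> real^'n^'n \<Rightarrow> bool" where
  "loewner_le A B \<longleftrightarrow> (\<forall>v. 0 \<le> v \<bullet> ((B - A) *v v))"

text \<open>The norm of the disturbance space is arbitrary, hence a function and not the class
  operation, which is the Euclidean norm.\<close>

definition is_norm :: "('v::real_vector \<Rightarrow> real) \<Rightarrow> bool" where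
  "is_norm N \<longleftrightarrow>
     (\<forall>x. 0 \<le> N x) \<and> (\<forall>x. N x = 0 \<longleftrightarrow> x = 0) \<and>
     (\<forall>c x. N (c *\<^sub>R x) = \<bar>c\<bar> * N x) \<and>
     (\<forall>x y. N (x + y) \<le> N x + N y)"

text \<open>Probability distributions on a set \<open>\<Xi>\<close> with its Borel sigma-algebra, which is the trace
  of the Borel sigma-algebra of the ambient space; \<open>\<Xi>\<close> itself need not be Borel.\<close>

definition distribution_on :: "'v::topological_space set \<Rightarrow> 'v measure \<Rightarrow> bool" where
  "distribution_on \<Xi> P \<longleftrightarrow> prob_space P \<and> sets P = sets (restrict_space borel \<Xi>)"

definition couplings :: "'v measure \<Rightarrow> 'v measure \<Rightarrow> ('v \<times> 'v) measure set" where
  "couplings P Q =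
     {J. prob_space J \<and> sets J = sets (P \<Otimes>\<^sub>M Q) \<and> distr J P fst = P \<and> distr J Q snd = Q}"

definition wasserstein ::
    "('v::real_vector \<Rightarrow> real) \<Rightarrow> 'v measure \<Rightarrow> 'v measure \<Rightarrow> ennreal" where
  "wasserstein N P Q =
     (INF J\<in>couplings P Q. \<integral>\<^sup>+ z. ennreal (N (fst z - snd z)) \<partial>J)"

definition proper_fun :: "('v \<Rightarrow> ereal) \<Rightarrow> bool" where
  "proper_fun h \<longleftrightarrow> (\<forall>x. h x \<noteq> -\<infinity>) \<and> (\<exists>x. h x \<noteq> \<infinity>)"

definition closed_fun :: "('v::topological_space \<Rightarrow> ereal) \<Rightarrow> bool" where
  "closed_fun h \<longleftrightarrow> closed {(x, s::real). h x \<le> ereal s}"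

definition indicator_infty :: "'v set \<Rightarrow> 'v \<Rightarrow> ereal" where
  "indicator_infty X x = (if x \<in> X then 0 else \<infinity>)"

definition prox :: "('v::real_normed_vector \<Rightarrow> ereal) \<Rightarrow> real \<Rightarrow> 'v \<Rightarrow> 'v" where
  "prox h \<alpha> u = (ARG_MIN (\<lambda>x. h x + ereal (1 / (2 * \<alpha>) * (norm (x - u))\<^sup>2)) x. True)"

definition expected_cost ::
    "(real^'n \<Rightarrow> 'v \<Rightarrow> real) \<Rightarrow> (int \<Rightarrow> 'v measure) \<Rightarrow> int \<Rightarrow> real^'n \<Rightarrow> real" where
  "expected_cost f P t x = (\<integral>w. f x w \<partial>P t)"

definition grad_estimate ::
    "(real^'n \<Rightarrow> 'v \<Rightarrow> real) \<Rightarrow> (int \<Rightarrow> nat \<Rightarrow> 'v) \<Rightarrow> nat \<Rightarrow> nat \<Rightarrow> int \<Rightarrow> real^'n \<Rightarrow> real^'n" where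
  "grad_estimate f w m q t x =
     (1 / (real m * real q)) *\<^sub>R
       (\<Sum>k = t - int q + 1..t. \<Sum>i = 1..m. grad (\<lambda>y. f y (w k i)) x)"

definition constrained_opt ::
    "'v set \<Rightarrow> (int \<Rightarrow> 'v \<Rightarrow> real) \<Rightarrow> int \<Rightarrow> 'v" where
  "constrained_opt X F t = arg_min_on (F t) X"

definition tracking_regret ::
    "(int \<Rightarrow> 'v \<Rightarrow> real) \<Rightarrow> (int \<Rightarrow> 'v) \<Rightarrow> (int \<Rightarrow> 'v) \<Rightarrow> nat \<Rightarrow> real" where
  "tracking_regret F x xs T = (\<Sum>t = 1..int T. F t (x t) - F t (xs t))"

definition estimation_regret ::
    "(int \<Rightarrow> 'v \<Rightarrow> real) \<Rightarrow> (int \<Rightarrow> 'v) \<Rightarrow> (int \<Rightarrow> 'v) \<Rightarrow> nat \<Rightarrow> real" where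
  "estimation_regret F x xs T = (\<Sum>t = 1..int T. F t (x (t + 1)) - F t (xs t))"

end

theory Submission
  imports Defs
begin

text \<open>
  Integrating the pointwise bounds on \<open>f(\<cdot>, w)\<close> shows that \<open>F_t\<close> lies between the quadratics with
  curvatures \<open>\<sigma>\<close> and \<open>L_x\<close> around each of its first-order expansions; this also gives its gradient,
  without any differentiation under the integral sign. For such functions co-coercivity makes the
  gradient step a contraction with factor \<open>r\<close>, and the minimiser over \<open>X\<close> is a fixed point of the
  projected gradient step. Since \<open>prox\<close> is the nonexpansive projection onto \<open>X\<close>, one gets
  \<open>\<parallel>x_(t+1) - x_t*\<parallel> \<le> r \<parallel>x_t - x_t*\<parallel> + \<alpha> \<parallel>\<epsilon>_t\<parallel>\<close>. Summing over \<open>t\<close> bounds the accumulated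
  distances, and convexity together with the gradient bound \<open>G\<close> turns distances into regret.
\<close>

section \<open>Gradients and derivatives along a line\<close>

text \<open>The definite description \<open>grad\<close> is justified by uniqueness: the Frechet
  derivative is unique, and an inner product functional determines its vector.\<close>

lemma GDERIV_imp_grad:
  assumes "GDERIV g x :> D"
  shows "grad g x = D"
proof -
  have "D' = D" if "GDERIV g x :> D'" for D'
  proof -
    have "(\<lambda>k. k \<bullet> D') = (\<lambda>k. k \<bullet> D)"
      using that assms unfolding gderiv_def by (rule has_derivative_unique)
    then show ?thesis
      by (metis vector_eq_ldot)
  qed
  then show ?thesis
    unfolding grad_def using assms by blast
qed

text \<open>The derivative is a linear functional, hence the inner product with a fixed vector, here
  \<open>adjoint g' 1\<close>.\<close>

lemma differentiable_imp_GDERIV_grad: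
  fixes g :: "real^'n \<Rightarrow> real"
  assumes "g differentiable (at x)"
  shows "GDERIV g x :> grad g x"
proof -
  obtain g' where g': "(g has_derivative g') (at x)"
    using assms by (auto simp: differentiable_def)
  then have "linear g'"
    by (rule has_derivative_linear)
  then have "g' y = y \<bullet> adjoint g' 1" for y
    using adjoint_works[of g' y 1] by simp
  then have "g' = (\<lambda>y. y \<bullet> adjoint g' 1)"
    by blast
  with g' have "GDERIV g x :> adjoint g' 1"
    by (simp add: gderiv_def)
  then show ?thesis
    using GDERIV_imp_grad by metis
qed

lemma GDERIV_along_line:
  assumes "GDERIV g (x + s *\<^sub>R v) :> D"
  shows "((\<lambda>s. g (x + s *\<^sub>R v)) has_real_derivative D \<bullet> v) (at s)"
proof -
  have "((\<lambda>s. x + s *\<^sub>R v) has_derivative (\<lambda>k. k *\<^sub>R v)) (at s)"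
    by (auto intro!: derivative_eq_intros)
  moreover have "(g has_derivative (\<lambda>k. k \<bullet> D)) (at (x + s *\<^sub>R v))"
    using assms by (simp add: gderiv_def)
  ultimately have "(g \<circ> (\<lambda>s. x + s *\<^sub>R v) has_derivative (\<lambda>k. k \<bullet> D) \<circ> (\<lambda>k. k *\<^sub>R v)) (at s)"
    by (rule diff_chain_at)
  then show ?thesis
    by (simp add: has_field_derivative_def o_def inner_commute mult_commute_abs)
qed

section \<open>Quadratic bounds from monotone gradients\<close>

text \<open>Along the segment, \<open>g\<close> minus the linear and quadratic terms has nonnegative
  derivative. The sign of \<open>c\<close> is free: applied to \<open>- g\<close> with
  \<open>c = - L\<close>, the lemma yields upper bounds as well.\<close>

lemma strongly_monotone_gradient_imp_quadratic_lower_bound: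
  fixes g :: "'a::real_inner \<Rightarrow> real"
  assumes deriv: "\<And>x. GDERIV g x :> D x"
    and mono: "\<And>x y. c * (norm (y - x))\<^sup>2 \<le> (D y - D x) \<bullet> (y - x)"
  shows "c / 2 * (norm (y - x))\<^sup>2 \<le> g y - g x - D x \<bullet> (y - x)"
proof -
  define v where "v = y - x"
  define \<phi> where "\<phi> s = g (x + s *\<^sub>R v) - s * (D x \<bullet> v) - c / 2 * s\<^sup>2 * (norm v)\<^sup>2" for s
  have "\<phi> 0 \<le> \<phi> 1"
  proof (rule DERIV_nonneg_imp_nondecreasing[where f = \<phi>])
    fix s :: real
    assume s: "0 \<le> s" "s \<le> 1"
    have "(\<phi> has_real_derivative (D (x + s *\<^sub>R v) - D x) \<bullet> v - c * s * (norm v)\<^sup>2) (at s)"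
      unfolding \<phi>_def
      by (rule derivative_eq_intros GDERIV_along_line[OF deriv] refl)+ (simp add: inner_diff_left)
    \<comment> \<open>Monotonicity controls only \<open>s\<close> times this derivative, so
      \<open>s\<close> is cancelled; at \<open>s = 0\<close> the derivative vanishes.\<close>
    moreover have "0 \<le> (D (x + s *\<^sub>R v) - D x) \<bullet> v - c * s * (norm v)\<^sup>2"
    proof (cases "s = 0")
      case False
      have "c * (s * norm v)\<^sup>2 \<le> s * ((D (x + s *\<^sub>R v) - D x) \<bullet> v)"
        using mono[where x = x and y = "x + s *\<^sub>R v"] s by simp
      then have "s * (c * s * (norm v)\<^sup>2) \<le> s * ((D (x + s *\<^sub>R v) - D x) \<bullet> v)"
        by (simp add: power2_eq_square mult_ac)
      with s False show ?thesis
        by simp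
    qed simp
    ultimately show "\<exists>d. (\<phi> has_real_derivative d) (at s) \<and> 0 \<le> d"
      by blast
  qed simp
  then show ?thesis
    by (simp add: \<phi>_def v_def)
qed

text \<open>The Hessian is the derivative of \<open>grad g\<close>, so its quadratic form in the
  direction \<open>v = y - x\<close> is the rate at which the component of the gradient along
  \<open>v\<close> grows on the segment.\<close>

lemma hessian_lower_bound_imp_strongly_monotone_grad:
  fixes g :: "real^'n \<Rightarrow> real"
  assumes diff: "\<And>x. grad g differentiable (at x)"
    and hess: "\<And>x. loewner_le (\<sigma> *\<^sub>R mat 1) (hessian g x)"
  shows "\<sigma> * (norm (y - x))\<^sup>2 \<le> (grad g y - grad g x) \<bullet> (y - x)"
proof -
  define v where "v = y - x"
  define \<phi> where "\<phi> s = grad g (x + s *\<^sub>R v) \<bullet> v - \<sigma> * s * (norm v)\<^sup>2" for s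
  have "\<phi> 0 \<le> \<phi> 1"
  proof (rule DERIV_nonneg_imp_nondecreasing[where f = \<phi>])
    fix s :: real
    let ?z = "x + s *\<^sub>R v"
    have "(grad g has_derivative (\<lambda>k. hessian g ?z *v k)) (at ?z)"
      using diff by (simp add: hessian_def flip: jacobian_works)
    then have "((\<lambda>s. grad g (x + s *\<^sub>R v)) has_derivative (\<lambda>k. hessian g ?z *v (k *\<^sub>R v))) (at s)"
      by (rule has_derivative_compose[rotated]) (auto intro!: derivative_eq_intros)
    then have "((\<lambda>s. grad g (x + s *\<^sub>R v) \<bullet> v) has_derivative
        (\<lambda>k. (hessian g ?z *v (k *\<^sub>R v)) \<bullet> v)) (at s)"
      by (rule has_derivative_inner_left)
    then have "((\<lambda>s. grad g (x + s *\<^sub>R v) \<bullet> v) has_real_derivative (hessian g ?z *v v) \<bullet> v) (at s)"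
      by (simp add: has_field_derivative_def matrix_vector_mult_scaleR mult_commute_abs)
    then have "(\<phi> has_real_derivative (hessian g ?z *v v) \<bullet> v - \<sigma> * (norm v)\<^sup>2) (at s)"
      unfolding \<phi>_def by (auto intro!: derivative_eq_intros)
    moreover have "0 \<le> (hessian g ?z *v v) \<bullet> v - \<sigma> * (norm v)\<^sup>2"
      using hess[of ?z]
      by (simp add: loewner_le_def matrix_vector_mult_diff_rdistrib scaleR_matrix_vector_assoc[symmetric]
          inner_diff_right inner_commute power2_norm_eq_inner)
    ultimately show "\<exists>d. (\<phi> has_real_derivative d) (at s) \<and> 0 \<le> d"
      by blast
  qed simp
  then show ?thesis
    by (simp add: \<phi>_def v_def inner_diff_left)
qed

section \<open>Smooth strongly convex functions: contraction and minimisers\<close>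

text \<open>Both bounds are linear in the pair of \<open>g\<close> and \<open>D\<close>, so they
  survive averaging over \<open>w\<close>. That \<open>D\<close> is the gradient is a consequence,
  not an axiom.\<close>

locale smooth_strongly_convex =
  fixes g :: "'a::euclidean_space \<Rightarrow> real" and D :: "'a \<Rightarrow> 'a" and \<sigma> L :: real
  assumes \<sigma>_pos: "0 < \<sigma>"
    and lower: "\<sigma> / 2 * (norm (y - x))\<^sup>2 \<le> g y - g x - D x \<bullet> (y - x)"
    and upper: "g y - g x - D x \<bullet> (y - x) \<le> L / 2 * (norm (y - x))\<^sup>2"
begin

lemma \<sigma>_le_L: "\<sigma> \<le> L"
proof -
  obtain b :: 'a where b: "b \<in> Basis"
    using nonempty_Basis by blast
  show ?thesis
    using order_trans[OF lower upper, of b 0] b by simp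
qed

text \<open>The first-order remainder lies between 0 and a multiple of the squared distance, so it
  is of smaller order than the distance. Within radius \<open>2 * c / L\<close> it is at most
  \<open>c\<close> times the distance.\<close>

lemma gderiv: "GDERIV g x :> D x"
  unfolding gderiv_def has_derivative_at_alt
proof (intro conjI allI impI)
  show "bounded_linear (\<lambda>k. k \<bullet> D x)"
    by (rule bounded_linear_inner_left)
  fix c :: real
  assume "0 < c"
  have L: "0 < L"
    using \<sigma>_pos \<sigma>_le_L by simp
  have "norm (g y - g x - (y - x) \<bullet> D x) \<le> c * norm (y - x)" if "norm (y - x) < 2 * c / L" for y
  proof -
    have "0 \<le> \<sigma> / 2 * (norm (y - x))\<^sup>2"
      using \<sigma>_pos by simp
    then have "norm (g y - g x - (y - x) \<bullet> D x) \<le> (L / 2 * norm (y - x)) * norm (y - x)"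
      using lower[of y x] upper[of y x] by (simp add: inner_commute power2_eq_square)
    also have "\<dots> \<le> c * norm (y - x)"
      using that L by (intro mult_right_mono) (auto simp: field_simps)
    finally show ?thesis .
  qed
  then show "\<exists>d>0. \<forall>y. norm (y - x) < d \<longrightarrow> norm (g y - g x - (y - x) \<bullet> D x) \<le> c * norm (y - x)"
    using \<open>0 < c\<close> L by (intro exI[of _ "2 * c / L"]) auto
qed

lemma first_order_lower_bound: "g x + D x \<bullet> (y - x) \<le> g y"
proof -
  have "0 \<le> \<sigma> / 2 * (norm (y - x))\<^sup>2"
    using \<sigma>_pos by simp
  then show ?thesis
    using lower[of y x] by linarith
qed

text \<open>Co-coercivity of the gradient of the convex, \<open>L - \<sigma>\<close>-smooth function
  \<open>y \<mapsto> g y - \<sigma>/2 \<parallel>y\<parallel>\<^sup>2\<close>. The free parameter \<open>s\<close>, ideally \<open>1 / (L - \<sigma>)\<close>, covers \<open>L = \<sigma>\<close>.\<close>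

lemma cocoercive_param:
  fixes x y :: 'a
  defines "d \<equiv> D x - D y - \<sigma> *\<^sub>R (x - y)"
  shows "(2 * s - (L - \<sigma>) * s\<^sup>2) * (d \<bullet> d) \<le> d \<bullet> (x - y)"
proof -
  \<comment> \<open>Subtracting the quadratic lowers both curvature bounds by \<sigma>:
    \<open>k\<close> is convex with upper curvature \<open>L - \<sigma>\<close>.\<close>
  define k where "k z = g z - \<sigma> / 2 * (z \<bullet> z)" for z
  define K where "K z = D z - \<sigma> *\<^sub>R z" for z
  have norm_sq: "(norm (v - u))\<^sup>2 = v \<bullet> v - 2 * (u \<bullet> v) + u \<bullet> u" for u v :: 'a
    by (simp add: power2_norm_eq_inner algebra_simps inner_commute)
  have k_lower: "0 \<le> k v - k u - K u \<bullet> (v - u)" for u v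
    using lower[of v u] unfolding norm_sq k_def K_def by (simp add: algebra_simps)
  have k_upper: "k v - k u - K u \<bullet> (v - u) \<le> (L - \<sigma>) / 2 * ((v - u) \<bullet> (v - u))" for u v
    using upper[of v u] unfolding norm_sq k_def K_def
    by (simp add: algebra_simps inner_commute diff_divide_distrib add_divide_distrib)
  \<comment> \<open>The test point is a gradient step of length \<open>s\<close> from
    \<open>v\<close> for the function \<open>k z - K u \<bullet> z\<close>, which is minimal at
    \<open>u\<close>. Convexity at \<open>u\<close> and smoothness at \<open>v\<close> are combined
    there.\<close>
  have half: "s * (c \<bullet> c) - (L - \<sigma>) / 2 * s\<^sup>2 * (c \<bullet> c) \<le> k v - k u - K u \<bullet> (v - u)"
    if c: "c = K u - K v" for u v c
  proof -
    have "0 \<le> k (v + s *\<^sub>R c) - k u - K u \<bullet> (v - u) - s * (K u \<bullet> c)"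
      using k_lower[of "v + s *\<^sub>R c" u] by (simp add: algebra_simps)
    moreover have "k (v + s *\<^sub>R c) - k v - s * (K v \<bullet> c) \<le> (L - \<sigma>) / 2 * s\<^sup>2 * (c \<bullet> c)"
      using k_upper[of "v + s *\<^sub>R c" v] by (simp add: power2_eq_square)
    moreover have "s * (c \<bullet> c) = s * (K u \<bullet> c) - s * (K v \<bullet> c)"
      by (simp add: c inner_diff_left right_diff_distrib)
    ultimately show ?thesis
      by linarith
  qed
  have d: "d = K x - K y"
    by (simp add: d_def K_def algebra_simps)
  have "(- d) \<bullet> (- d) = d \<bullet> d"
    by simp
  \<comment> \<open>Adding the two instances with \<open>x\<close> and \<open>y\<close> exchanged
    cancels the values of \<open>k\<close>.\<close>
  with half[OF d] half[of "- d" y x]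
  have "2 * (s * (d \<bullet> d) - (L - \<sigma>) / 2 * s\<^sup>2 * (d \<bullet> d))
      \<le> (k y - k x - K x \<bullet> (y - x)) + (k x - k y - K y \<bullet> (x - y))"
    by (simp add: d)
  also have "\<dots> = d \<bullet> (x - y)"
    by (simp add: d algebra_simps)
  also have "2 * (s * (d \<bullet> d) - (L - \<sigma>) / 2 * s\<^sup>2 * (d \<bullet> d)) = (2 * s - (L - \<sigma>) * s\<^sup>2) * (d \<bullet> d)"
    by (simp add: field_simps)
  finally show ?thesis .
qed

text \<open>For \<open>L > \<sigma>\<close> the best \<open>s\<close> is
  \<open>1 / (L - \<sigma>)\<close>. For \<open>L = \<sigma>\<close> a bound linear in
  \<open>s\<close> holds for every \<open>s\<close>, which forces
  \<open>d \<bullet> d = 0\<close>.\<close>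

lemma cocoercive:
  fixes x y :: 'a
  defines "d \<equiv> D x - D y - \<sigma> *\<^sub>R (x - y)"
  shows "d \<bullet> d \<le> (L - \<sigma>) * (d \<bullet> (x - y))"
proof (cases "L = \<sigma>")
  case True
  have bound: "2 * s * (d \<bullet> d) \<le> d \<bullet> (x - y)" for s
    using cocoercive_param[of s x y] True by (simp add: d_def)
  have "d \<bullet> d = 0"
  proof (rule ccontr)
    assume "d \<bullet> d \<noteq> 0"
    then show False
      \<comment> \<open>This \<open>s\<close> makes the left side exceed the right side by exactly
        1.\<close>
      using bound[of "(d \<bullet> (x - y) + 1) / (2 * (d \<bullet> d))"] by simp
  qed
  with True show ?thesis
    by simp
next
  case False
  then have "0 < L - \<sigma>"
    using \<sigma>_le_L by simp
  moreover have "2 * (1 / (L - \<sigma>)) - (L - \<sigma>) * (1 / (L - \<sigma>))\<^sup>2 = 1 / (L - \<sigma>)"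
    using False by (simp add: power2_eq_square)
  then have "1 / (L - \<sigma>) * (d \<bullet> d) \<le> d \<bullet> (x - y)"
    using cocoercive_param[of "1 / (L - \<sigma>)" x y] unfolding d_def by simp
  ultimately show ?thesis
    by (simp add: pos_divide_le_eq mult.commute)
qed

text \<open>With the gradient difference split as \<open>\<sigma>\<close> times \<open>v\<close>
  plus \<open>d\<close>, co-coercivity removes \<open>d \<bullet> d\<close>. The remaining bound is
  affine in \<open>d \<bullet> v\<close>, and its values at the ends of the admissible interval are
  the two squared factors times \<open>v \<bullet> v\<close>.\<close>

lemma gradient_step_contraction:
  assumes "0 < \<alpha>"
  shows "norm ((x - \<alpha> *\<^sub>R D x) - (y - \<alpha> *\<^sub>R D y)) \<le> max \<bar>1 - \<alpha> * L\<bar> \<bar>1 - \<alpha> * \<sigma>\<bar> * norm (x - y)"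
proof -
  define v where "v = x - y"
  define d where "d = D x - D y - \<sigma> *\<^sub>R v"
  have dd: "d \<bullet> d \<le> (L - \<sigma>) * (d \<bullet> v)"
    unfolding d_def v_def by (rule cocoercive)
  have norm_sq: "(norm (u - w))\<^sup>2 = u \<bullet> u - 2 * (u \<bullet> w) + w \<bullet> w" for u w :: 'a
    by (simp add: power2_norm_eq_inner algebra_simps inner_commute)
  \<comment> \<open>Adding each quadratic bound to its copy with \<open>x\<close> and
    \<open>y\<close> exchanged cancels the values of \<open>g\<close>.\<close>
  have dv: "0 \<le> d \<bullet> v" "d \<bullet> v \<le> (L - \<sigma>) * (v \<bullet> v)"
    using lower[of y x] upper[of y x] lower[of x y] upper[of x y]
    unfolding norm_sq d_def v_def by (simp_all add: algebra_simps inner_commute)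
  have "(norm ((x - \<alpha> *\<^sub>R D x) - (y - \<alpha> *\<^sub>R D y)))\<^sup>2 = (norm ((1 - \<alpha> * \<sigma>) *\<^sub>R v - \<alpha> *\<^sub>R d))\<^sup>2"
    by (simp add: d_def v_def algebra_simps)
  also have "\<dots> = (1 - \<alpha> * \<sigma>)\<^sup>2 * (v \<bullet> v) - 2 * \<alpha> * (1 - \<alpha> * \<sigma>) * (d \<bullet> v) + \<alpha>\<^sup>2 * (d \<bullet> d)"
    unfolding norm_sq by (simp add: power2_eq_square inner_commute algebra_simps)
  also have "\<dots> \<le> (1 - \<alpha> * \<sigma>)\<^sup>2 * (v \<bullet> v) - 2 * \<alpha> * (1 - \<alpha> * \<sigma>) * (d \<bullet> v)
      + \<alpha>\<^sup>2 * ((L - \<sigma>) * (d \<bullet> v))"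
    using dd by (intro add_left_mono mult_left_mono) auto
  also have "\<dots> = (1 - \<alpha> * \<sigma>)\<^sup>2 * (v \<bullet> v) + \<alpha> * (\<alpha> * (L + \<sigma>) - 2) * (d \<bullet> v)"
    by (simp add: power2_eq_square algebra_simps)
  also have "\<dots> \<le> (max \<bar>1 - \<alpha> * L\<bar> \<bar>1 - \<alpha> * \<sigma>\<bar>)\<^sup>2 * (v \<bullet> v)"
  \<comment> \<open>The sign of the slope in \<open>d \<bullet> v\<close> decides which end of the
    interval is extremal.\<close>
  proof (cases "\<alpha> * (L + \<sigma>) \<le> 2")
    case True
    then have "\<alpha> * (\<alpha> * (L + \<sigma>) - 2) * (d \<bullet> v) \<le> 0"
      using assms dv by (intro mult_nonpos_nonneg mult_nonneg_nonpos) auto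
    moreover have "(1 - \<alpha> * \<sigma>)\<^sup>2 \<le> (max \<bar>1 - \<alpha> * L\<bar> \<bar>1 - \<alpha> * \<sigma>\<bar>)\<^sup>2"
      by (subst power2_abs[symmetric], rule power_mono) auto
    then have "(1 - \<alpha> * \<sigma>)\<^sup>2 * (v \<bullet> v) \<le> (max \<bar>1 - \<alpha> * L\<bar> \<bar>1 - \<alpha> * \<sigma>\<bar>)\<^sup>2 * (v \<bullet> v)"
      by (rule mult_right_mono) simp
    ultimately show ?thesis
      by linarith
  next
    case False
    then have "\<alpha> * (\<alpha> * (L + \<sigma>) - 2) * (d \<bullet> v) \<le> \<alpha> * (\<alpha> * (L + \<sigma>) - 2) * ((L - \<sigma>) * (v \<bullet> v))"
      using assms dv by (intro mult_left_mono) auto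
    then have "(1 - \<alpha> * \<sigma>)\<^sup>2 * (v \<bullet> v) + \<alpha> * (\<alpha> * (L + \<sigma>) - 2) * (d \<bullet> v)
        \<le> (1 - \<alpha> * L)\<^sup>2 * (v \<bullet> v)"
      by (simp add: power2_eq_square algebra_simps)
    also have "(1 - \<alpha> * L)\<^sup>2 \<le> (max \<bar>1 - \<alpha> * L\<bar> \<bar>1 - \<alpha> * \<sigma>\<bar>)\<^sup>2"
      by (subst power2_abs[symmetric], rule power_mono) auto
    then have "(1 - \<alpha> * L)\<^sup>2 * (v \<bullet> v) \<le> (max \<bar>1 - \<alpha> * L\<bar> \<bar>1 - \<alpha> * \<sigma>\<bar>)\<^sup>2 * (v \<bullet> v)"
      by (rule mult_right_mono) simp
    finally show ?thesis .
  qed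
  also have "\<dots> = (max \<bar>1 - \<alpha> * L\<bar> \<bar>1 - \<alpha> * \<sigma>\<bar> * norm v)\<^sup>2"
    by (simp add: power_mult_distrib power2_norm_eq_inner)
  finally show ?thesis
    unfolding v_def by (rule power2_le_imp_le) (auto intro: mult_nonneg_nonneg simp: le_max_iff_disj)
qed

text \<open>Both \<open>\<alpha> * \<sigma>\<close> and \<open>\<alpha> * L\<close> lie strictly
  between 0 and 2.\<close>

lemma contraction_factor_less_one:
  assumes "0 < \<alpha>" "\<alpha> < 2 / L"
  shows "max \<bar>1 - \<alpha> * L\<bar> \<bar>1 - \<alpha> * \<sigma>\<bar> < 1"
proof -
  have "0 < L"
    using \<sigma>_pos \<sigma>_le_L by simp
  then have "\<alpha> * L < 2"
    using assms by (simp add: field_simps)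
  moreover have "\<alpha> * \<sigma> \<le> \<alpha> * L" "0 < \<alpha> * \<sigma>"
    using assms \<sigma>_le_L \<sigma>_pos by simp_all
  ultimately show ?thesis
    by auto
qed

text \<open>Since \<open>arg_min_on\<close> is a choice, a minimiser has to exist first. Strong
  convexity confines the search to a compact piece of \<open>X\<close>.\<close>

lemma arg_min_on_minimises:
  assumes "closed X" "X \<noteq> {}"
  shows "arg_min_on g X \<in> X" and "\<And>y. y \<in> X \<Longrightarrow> g (arg_min_on g X) \<le> g y"
proof -
  obtain a where a: "a \<in> X"
    using assms by blast
  \<comment> \<open>Beyond distance \<open>R\<close> from \<open>a\<close> the quadratic term
    outweighs the linear one, so \<open>g\<close> is at least \<open>g a\<close> there.\<close>
  define R where "R = 2 * norm (D a) / \<sigma>"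
  have R: "0 \<le> R"
    using \<sigma>_pos by (simp add: R_def)
  have "continuous_on UNIV g"
    using gderiv unfolding gderiv_def
    by (intro continuous_at_imp_continuous_on ballI) (rule has_derivative_continuous)
  then have "continuous_on (X \<inter> cball a R) g"
    by (rule continuous_on_subset) simp
  moreover have "compact (X \<inter> cball a R)"
    using assms by (simp add: closed_Int_compact)
  moreover have "X \<inter> cball a R \<noteq> {}"
    using a R by auto
  ultimately obtain z where z: "z \<in> X" "\<And>y. y \<in> X \<inter> cball a R \<Longrightarrow> g z \<le> g y"
    by (metis continuous_attains_inf IntD1)
  have "g z \<le> g y" if y: "y \<in> X" for y
  proof (cases "y \<in> cball a R")
    case False
    then have "R * norm (y - a) \<le> norm (y - a) * norm (y - a)"
      by (intro mult_right_mono) (auto simp: dist_norm norm_minus_commute)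
    then have "\<sigma> / 2 * (R * norm (y - a)) \<le> \<sigma> / 2 * (norm (y - a))\<^sup>2"
      using \<sigma>_pos unfolding power2_eq_square by (intro mult_left_mono) auto
    moreover have "\<sigma> / 2 * (R * norm (y - a)) = norm (D a) * norm (y - a)"
      using \<sigma>_pos by (simp add: R_def)
    moreover have "- (norm (D a) * norm (y - a)) \<le> D a \<bullet> (y - a)"
      using Cauchy_Schwarz_ineq2[of "D a" "y - a"] by linarith
    ultimately have "g a \<le> g y"
      using lower[of y a] by linarith
    moreover have "g z \<le> g a"
      using z a R by simp
    ultimately show ?thesis
      by simp
  qed (use z y in simp)
  then have "is_arg_min g (\<lambda>y. y \<in> X) z"
    using z by (auto simp: is_arg_min_def not_less)
  then have "is_arg_min g (\<lambda>y. y \<in> X) (arg_min_on g X)"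
    unfolding arg_min_on_def arg_min_def by (rule someI)
  then show "arg_min_on g X \<in> X" "\<And>y. y \<in> X \<Longrightarrow> g (arg_min_on g X) \<le> g y"
    by (auto simp: is_arg_min_def not_less)
qed

text \<open>A negative directional derivative towards \<open>y\<close> would let a short step inside
  the convex set decrease \<open>g\<close>.\<close>

lemma minimiser_variational_inequality:
  assumes "convex X" "z \<in> X" "\<And>y. y \<in> X \<Longrightarrow> g z \<le> g y" "y \<in> X"
  shows "0 \<le> D z \<bullet> (y - z)"
proof (rule ccontr)
  assume "\<not> 0 \<le> D z \<bullet> (y - z)"
  then have neg: "D z \<bullet> (y - z) < 0"
    by simp
  have "((\<lambda>s. g (z + s *\<^sub>R (y - z))) has_real_derivative D z \<bullet> (y - z)) (at 0)"
    using GDERIV_along_line[of g z 0 "y - z" "D z"] gderiv by simp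
  from DERIV_neg_dec_right[OF this neg]
  obtain \<delta> where \<delta>: "0 < \<delta>" "\<And>s. 0 < s \<Longrightarrow> s < \<delta> \<Longrightarrow> g (z + s *\<^sub>R (y - z)) < g z"
    by auto
  define s where "s = min (\<delta> / 2) 1"
  have s: "0 < s" "s < \<delta>" "s \<le> 1"
    using \<delta> by (auto simp: s_def)
  have "z + s *\<^sub>R (y - z) = (1 - s) *\<^sub>R z + s *\<^sub>R y"
    by (simp add: algebra_simps)
  also have "\<dots> \<in> X"
    using assms s by (intro convexD) auto
  finally show False
    using assms(3) \<delta>(2) s by force
qed

text \<open>Expanding the squared distance from the gradient step to any \<open>y\<close> in
  \<open>X\<close> gives a cross term that is nonnegative by the variational inequality, so no point
  of \<open>X\<close> is closer than \<open>z\<close>.\<close>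

lemma minimiser_fixed_point:
  assumes X: "closed X" "convex X"
    and z: "z \<in> X" "\<And>y. y \<in> X \<Longrightarrow> g z \<le> g y" and "0 < \<alpha>"
  shows "closest_point X (z - \<alpha> *\<^sub>R D z) = z"
proof -
  have "dist (z - \<alpha> *\<^sub>R D z) z \<le> dist (z - \<alpha> *\<^sub>R D z) y" if "y \<in> X" for y
  proof -
    have "(norm (\<alpha> *\<^sub>R D z))\<^sup>2 \<le> (norm (y - z))\<^sup>2 + 2 * \<alpha> * (D z \<bullet> (y - z)) + (norm (\<alpha> *\<^sub>R D z))\<^sup>2"
      using minimiser_variational_inequality[OF X(2) z that] \<open>0 < \<alpha>\<close> by simp
    also have "\<dots> = (norm ((y - z) + \<alpha> *\<^sub>R D z))\<^sup>2"
      unfolding power2_norm_eq_inner by (simp add: inner_add_left inner_add_right inner_commute)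
    finally have "norm (\<alpha> *\<^sub>R D z) \<le> norm ((y - z) + \<alpha> *\<^sub>R D z)"
      by (rule power2_le_imp_le) simp
    also have "\<dots> = dist (z - \<alpha> *\<^sub>R D z) y"
      by (simp add: dist_norm norm_minus_commute algebra_simps)
    finally show ?thesis
      by (simp add: dist_norm)
  qed
  then show ?thesis
    using closest_point_unique[OF X(2,1) z(1)] by metis
qed

end

section \<open>The proximal map of an indicator function\<close>

text \<open>On \<open>X\<close> the objective increases with the distance to \<open>u\<close>,
  elsewhere it is infinite. Uniqueness of the closest point in a closed convex set pins down the
  choice made by \<open>ARG_MIN\<close>.\<close>

lemma prox_indicator_infty:
  fixes X :: "'a::euclidean_space set"
  assumes X: "closed X" "convex X" "X \<noteq> {}" and "0 < \<alpha>"
  shows "prox (indicator_infty X) \<alpha> u = closest_point X u"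
proof -
  define J where "J = (\<lambda>x. indicator_infty X x + ereal (1 / (2 * \<alpha>) * (norm (x - u))\<^sup>2))"
  have J_in: "J y = ereal (1 / (2 * \<alpha>) * (dist u y)\<^sup>2)" if "y \<in> X" for y
    using that by (simp add: J_def indicator_infty_def dist_norm norm_minus_commute)
  have J_out: "J y = \<infinity>" if "y \<notin> X" for y
    using that by (simp add: J_def indicator_infty_def)
  have cp: "closest_point X u \<in> X"
    using X by (simp add: closest_point_in_set)
  have le: "J y \<le> J z \<longleftrightarrow> dist u y \<le> dist u z" if "y \<in> X" "z \<in> X" for y z
    using that \<open>0 < \<alpha>\<close> by (simp add: J_in divide_le_cancel)
  have "J (closest_point X u) \<le> J y" for y
    using X cp le[of "closest_point X u" y] J_out[of y] closest_point_le[of X y u]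
    by (cases "y \<in> X") auto
  then have "is_arg_min J (\<lambda>_. True) (closest_point X u)"
    by (simp add: is_arg_min_linorder)
  then have min: "is_arg_min J (\<lambda>_. True) (prox (indicator_infty X) \<alpha> u)"
    unfolding prox_def J_def[symmetric] arg_min_def by (rule someI)
  define p where "p = prox (indicator_infty X) \<alpha> u"
  have p_min: "J p \<le> J y" for y
    using min by (simp add: p_def is_arg_min_linorder)
  have "p \<in> X"
    using p_min[of "closest_point X u"] cp J_in J_out by fastforce
  moreover have "\<forall>y\<in>X. dist u p \<le> dist u y"
    using p_min le \<open>p \<in> X\<close> by blast
  ultimately show ?thesis
    using closest_point_unique[OF X(2,1)] unfolding p_def by metis
qed

section \<open>From the pointwise cost to the expected cost\<close>

lemma smooth_strongly_convex_of_hessian: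
  fixes g :: "real^'n \<Rightarrow> real"
  assumes "0 < \<sigma>" and "twice_cont_diff g"
    and hess: "\<And>x. loewner_le (\<sigma> *\<^sub>R mat 1) (hessian g x)"
    and lip: "\<And>x y. norm (grad g x - grad g y) \<le> L * norm (x - y)"
  shows "smooth_strongly_convex g (grad g) \<sigma> L"
proof
  have deriv: "GDERIV g x :> grad g x" for x
    using assms(2) by (simp add: twice_cont_diff_def differentiable_imp_GDERIV_grad)
  have diff: "grad g differentiable (at x)" for x
    using assms(2) by (simp add: twice_cont_diff_def)
  fix x y :: "real^'n"
  show "\<sigma> / 2 * (norm (y - x))\<^sup>2 \<le> g y - g x - grad g x \<bullet> (y - x)"
    by (rule strongly_monotone_gradient_imp_quadratic_lower_bound[OF deriv
          hessian_lower_bound_imp_strongly_monotone_grad[OF diff hess]])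
  \<comment> \<open>The Lipschitz bound is monotonicity of the gradient of \<open>- g\<close> with
    the negative constant \<open>- L\<close>; this gives the upper quadratic.\<close>
  have "(- L) * (norm (v - u))\<^sup>2 \<le> (- grad g v - - grad g u) \<bullet> (v - u)" for u v
  proof -
    have "(grad g v - grad g u) \<bullet> (v - u) \<le> norm (grad g v - grad g u) * norm (v - u)"
      by (rule norm_cauchy_schwarz)
    also have "\<dots> \<le> (L * norm (v - u)) * norm (v - u)"
      using lip by (rule mult_right_mono) simp
    finally show ?thesis
      by (simp add: power2_eq_square algebra_simps)
  qed
  from strongly_monotone_gradient_imp_quadratic_lower_bound[OF GDERIV_minus[OF deriv] this, of y x]
  show "g y - g x - grad g x \<bullet> (y - x) \<le> L / 2 * (norm (y - x))\<^sup>2"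
    by simp
qed fact

text \<open>The remainder \<open>?r\<close> is integrated between its two bounds, which are constant
  in \<open>w\<close> and keep their value under a probability measure.\<close>

lemma smooth_strongly_convex_expectation:
  fixes \<phi> :: "real^'n \<Rightarrow> 'v \<Rightarrow> real"
  assumes "prob_space Q" and "0 < \<sigma>"
    and ssc: "\<And>w. w \<in> space Q \<Longrightarrow> smooth_strongly_convex (\<lambda>y. \<phi> y w) (\<lambda>y. D y w) \<sigma> L"
    and int: "\<And>y. integrable Q (\<phi> y)" "\<And>y i. integrable Q (\<lambda>w. D y w $ i)"
  shows "smooth_strongly_convex (\<lambda>y. \<integral>w. \<phi> y w \<partial>Q) (\<lambda>y. \<chi> i. \<integral>w. D y w $ i \<partial>Q) \<sigma> L"
proof
  interpret prob_space Q by fact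
  fix x y :: "real^'n"
  let ?r = "\<lambda>w. \<phi> y w - \<phi> x w - D x w \<bullet> (y - x)"
  have inner: "D x w \<bullet> (y - x) = (\<Sum>i\<in>UNIV. D x w $ i * (y - x) $ i)" for w
    by (simp add: inner_vec_def)
  have int_D: "integrable Q (\<lambda>w. D x w \<bullet> (y - x))"
    unfolding inner by (intro Bochner_Integration.integrable_sum integrable_mult_left int)
  have int_r: "integrable Q ?r"
    by (intro Bochner_Integration.integrable_diff int int_D)
  have "(\<integral>w. D x w \<bullet> (y - x) \<partial>Q) = (\<chi> i. \<integral>w. D x w $ i \<partial>Q) \<bullet> (y - x)"
    unfolding inner by (simp add: inner_vec_def int integral_mult_left)
  then have eq: "(\<integral>w. ?r w \<partial>Q)
      = (\<integral>w. \<phi> y w \<partial>Q) - (\<integral>w. \<phi> x w \<partial>Q) - (\<chi> i. \<integral>w. D x w $ i \<partial>Q) \<bullet> (y - x)"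
    by (simp add: int int_D)
  have "(\<integral>w. \<sigma> / 2 * (norm (y - x))\<^sup>2 \<partial>Q) \<le> (\<integral>w. ?r w \<partial>Q)"
    by (rule integral_mono[OF _ int_r]) (simp, rule smooth_strongly_convex.lower[OF ssc])
  then show "\<sigma> / 2 * (norm (y - x))\<^sup>2
      \<le> (\<integral>w. \<phi> y w \<partial>Q) - (\<integral>w. \<phi> x w \<partial>Q) - (\<chi> i. \<integral>w. D x w $ i \<partial>Q) \<bullet> (y - x)"
    unfolding eq by (simp add: prob_space)
  have "(\<integral>w. ?r w \<partial>Q) \<le> (\<integral>w. L / 2 * (norm (y - x))\<^sup>2 \<partial>Q)"
    by (rule integral_mono[OF int_r]) (simp, rule smooth_strongly_convex.upper[OF ssc])
  then show "(\<integral>w. \<phi> y w \<partial>Q) - (\<integral>w. \<phi> x w \<partial>Q) - (\<chi> i. \<integral>w. D x w $ i \<partial>Q) \<bullet> (y - x)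
      \<le> L / 2 * (norm (y - x))\<^sup>2"
    unfolding eq by (simp add: prob_space)
qed fact

section \<open>Summing contraction recursions\<close>

lemma sum_int_split_first:
  fixes u :: "int \<Rightarrow> real"
  assumes "0 < T"
  shows "(\<Sum>t = 1..int T. u t) = u 1 + (\<Sum>t = 1..int T - 1. u (t + 1))"
proof -
  have "{1..int T} = insert 1 {2..int T}"
    using assms by auto
  then have "(\<Sum>t = 1..int T. u t) = u 1 + (\<Sum>t = 2..int T. u t)"
    by simp
  also have "(\<Sum>t = 2..int T. u t) = (\<Sum>t = 1..int T - 1. u (t + 1))"
    by (rule sum.reindex_bij_witness[of _ "\<lambda>t. t + 1" "\<lambda>t. t - 1"]) auto
  finally show ?thesis .
qed

lemma sum_int_split_last:
  fixes u :: "int \<Rightarrow> real"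
  assumes "0 < T"
  shows "(\<Sum>t = 1..int T. u t) = (\<Sum>t = 1..int T - 1. u t) + u (int T)"
proof -
  have "{1..int T} = insert (int T) {1..int T - 1}"
    using assms by auto
  then show ?thesis
    by simp
qed

text \<open>Summing up to \<open>T - 1\<close> gives the full sum without \<open>u 1\<close> on the
  left and \<open>r\<close> times the full sum without \<open>u (int T)\<close> on the right;
  solving for the sum divides by \<open>1 - r\<close>.\<close>

lemma sum_le_of_contraction_recursion:
  fixes u b :: "int \<Rightarrow> real"
  assumes "r < 1" "0 < T"
    and step: "\<And>t. 1 \<le> t \<Longrightarrow> t < int T \<Longrightarrow> u (t + 1) \<le> r * u t + b t"
  shows "(\<Sum>t = 1..int T. u t) \<le> (u 1 - r * u (int T) + (\<Sum>t = 1..int T - 1. b t)) / (1 - r)"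
proof -
  have "(\<Sum>t = 1..int T - 1. u (t + 1)) \<le> (\<Sum>t = 1..int T - 1. r * u t + b t)"
    by (intro sum_mono step) auto
  also have "\<dots> = r * ((\<Sum>t = 1..int T. u t) - u (int T)) + (\<Sum>t = 1..int T - 1. b t)"
    using sum_int_split_last[OF \<open>0 < T\<close>, of u] by (simp add: sum.distrib sum_distrib_left)
  finally have "(1 - r) * (\<Sum>t = 1..int T. u t) \<le> u 1 - r * u (int T) + (\<Sum>t = 1..int T - 1. b t)"
    using sum_int_split_first[OF \<open>0 < T\<close>, of u] by (simp add: algebra_simps)
  then show ?thesis
    using \<open>r < 1\<close> by (simp add: pos_le_divide_eq mult.commute)
qed

section \<open>The dynamic regret bounds\<close>

text \<open>Convexity bounds the regret at a point through the gradient at that same point, and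
  \<open>G\<close> controls gradients only on \<open>X\<close>. Hence the premise
  \<open>x 1 \<in> X\<close> for tracking; all later iterates are projections onto
  \<open>X\<close>.\<close>

theorem theorem2:
  fixes X :: "(real^'n) set"
    and \<Xi> :: "(real^'w) set"
    and N :: "real^'w \<Rightarrow> real"
    and P :: "int \<Rightarrow> (real^'w) measure"
    and f :: "real^'n \<Rightarrow> real^'w \<Rightarrow> real"
    and L_x L_w \<sigma> \<rho> a \<alpha> r G :: real
    and m q T :: nat
    and M :: "'s measure"
    and W :: "int \<Rightarrow> nat \<Rightarrow> 's \<Rightarrow> real^'w"
    and \<omega> :: 's
    and h :: "real^'n \<Rightarrow> ereal"
    and x :: "int \<Rightarrow> real^'n"
    and F :: "int \<Rightarrow> real^'n \<Rightarrow> real"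
    and \<eta> :: "int \<Rightarrow> real^'n \<Rightarrow> real^'n"
    and xs \<epsilon> :: "int \<Rightarrow> real^'n"
    and e ebar :: "int \<Rightarrow> real"
    and V E :: real
  assumes "0 < m" "0 < q" "0 < T"
    and "closed X" "convex X"
    and "is_norm N"
    and "\<forall>t\<ge>2 - int q. distribution_on \<Xi> (P t) \<and> integrable (P t) N"
    and "0 < L_x" "0 < L_w" "0 < \<sigma>" "0 \<le> \<rho>"
    and "\<forall>w\<in>\<Xi>. twice_cont_diff (\<lambda>y. f y w)"
    and "\<forall>t\<ge>2 - int q. \<forall>y.
           integrable (P t) (\<lambda>w. f y w) \<and>
           (\<forall>i. integrable (P t) (\<lambda>w. grad (\<lambda>z. f z w) y $ i)) \<and>
           (\<forall>i j. integrable (P t) (\<lambda>w. hessian (\<lambda>z. f z w) y $ i $ j))"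
    and "\<forall>y. \<exists>B. \<forall>t\<ge>2 - int q.
           (\<integral>w. \<bar>f y w\<bar> \<partial>P t) \<le> B \<and>
           (\<forall>i. (\<integral>w. \<bar>grad (\<lambda>z. f z w) y $ i\<bar> \<partial>P t) \<le> B) \<and>
           (\<forall>i j. (\<integral>w. \<bar>hessian (\<lambda>z. f z w) y $ i $ j\<bar> \<partial>P t) \<le> B)"
    and "\<forall>t\<ge>2 - int q. wasserstein N (P (t + 1)) (P t) \<le> ennreal \<rho>"
    and "\<forall>y y'. \<forall>w\<in>\<Xi>.
           norm (grad (\<lambda>z. f z w) y - grad (\<lambda>z. f z w) y') \<le> L_x * norm (y - y')"
    and "\<forall>y i. \<forall>w\<in>\<Xi>. \<forall>w'\<in>\<Xi>.
           \<bar>grad (\<lambda>z. f z w) y $ i - grad (\<lambda>z. f z w') y $ i\<bar> \<le> L_w * N (w - w')"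
    and "\<forall>y. \<forall>w\<in>\<Xi>. loewner_le (\<sigma> *\<^sub>R mat 1) (hessian (\<lambda>z. f z w) y)"
    and "1 < a" "\<forall>k\<ge>2 - int q. integrable (P k) (\<lambda>w. exp (N w powr a))"
    and "prob_space M"
    and "\<forall>k\<ge>2 - int q. \<forall>i\<in>{1..m}.
           W k i \<in> measurable M (P k) \<and> distr M (P k) (W k i) = P k"
    and "\<omega> \<in> space M"
    and "proper_fun h" "closed_fun h" "h = indicator_infty X"
    and "0 < \<alpha>" "\<alpha> < 2 / L_x"
    and "r = max \<bar>1 - \<alpha> * L_x\<bar> \<bar>1 - \<alpha> * \<sigma>\<bar>"
  defines "F \<equiv> expected_cost f P"
    and "\<eta> \<equiv> grad_estimate f (\<lambda>k i. W k i \<omega>) m q"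
    and "xs \<equiv> constrained_opt X F"
  assumes "\<forall>t\<ge>1. x (t + 1) = prox h \<alpha> (x t - \<alpha> *\<^sub>R \<eta> t (x t))"
    and "0 < G" "\<forall>t\<ge>2 - int q. \<forall>y\<in>X. norm (grad (F t) y) \<le> G"
  defines "e \<equiv> \<lambda>t. norm (x t - xs t)"
    and "ebar \<equiv> \<lambda>t. norm (x (t + 1) - xs t)"
    and "\<epsilon> \<equiv> \<lambda>t. grad (F t) (x t) - \<eta> t (x t)"
    and "V \<equiv> \<Sum>t = 1..int T - 1. norm (xs (t + 1) - xs t)"
    and "E \<equiv> \<Sum>t = 1..int T. norm (\<epsilon> t)"
  shows "(x 1 \<in> X \<longrightarrow> tracking_regret F x xs T
             \<le> G / (1 - r) * ((e 1 - r * e (int T) - \<alpha> * norm (\<epsilon> (int T))) + \<alpha> * E + V))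
       \<and> estimation_regret F x xs T
             \<le> G / (1 - r) * ((ebar 1 - r * ebar (int T) - \<alpha> * norm (\<epsilon> 1)) + \<alpha> * E + r * V)"
proof -
  note X = \<open>closed X\<close> \<open>convex X\<close> and distr = assms(7) and int = assms(13) and x_step = assms(33)
    and G_bound = assms(35) and \<alpha> = \<open>0 < \<alpha>\<close> \<open>\<alpha> < 2 / L_x\<close>
  \<comment> \<open>A proper \<open>h\<close> is finite somewhere, and the indicator is finite only
    on \<open>X\<close>.\<close>
  have X_ne: "X \<noteq> {}"
    using assms(24,26) by (auto simp: proper_fun_def indicator_infty_def)
  have window: "2 - int q \<le> t" if "1 \<le> t" for t
    using that \<open>0 < q\<close> by simp
  have ssc: "smooth_strongly_convex (F t) (grad (F t)) \<sigma> L_x" if t: "1 \<le> t" for t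
  proof -
    have "prob_space (P t)" and space: "space (P t) = \<Xi>"
      using distr window[OF t] sets_eq_imp_space_eq[of "P t" "restrict_space borel \<Xi>"]
      by (auto simp: distribution_on_def space_restrict_space)
    have "smooth_strongly_convex (F t) (\<lambda>y. \<chi> i. \<integral>w. grad (\<lambda>z. f z w) y $ i \<partial>P t) \<sigma> L_x"
      unfolding F_def expected_cost_def
    proof (rule smooth_strongly_convex_expectation)
      show "smooth_strongly_convex (\<lambda>y. f y w) (grad (\<lambda>y. f y w)) \<sigma> L_x" if "w \<in> space (P t)" for w
        using that assms(10,12,16,18) by (intro smooth_strongly_convex_of_hessian) (auto simp: space)
    qed (use \<open>prob_space (P t)\<close> int window[OF t] \<open>0 < \<sigma>\<close> in auto)
    \<comment> \<open>The averaged gradient is the gradient of \<open>F t\<close> because the two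
      quadratic bounds already imply differentiability.\<close>
    moreover from this
    have "grad (F t) = (\<lambda>y. \<chi> i. \<integral>w. grad (\<lambda>z. f z w) y $ i \<partial>P t)"
      by (intro ext GDERIV_imp_grad smooth_strongly_convex.gderiv)
    ultimately show ?thesis
      by simp
  qed
  have r: "r < 1" "0 \<le> r"
    using smooth_strongly_convex.contraction_factor_less_one[OF ssc[of 1] \<alpha>] assms(29) by auto
  have xs_in: "xs t \<in> X" and xs_min: "\<And>y. y \<in> X \<Longrightarrow> F t (xs t) \<le> F t y" if "1 \<le> t" for t
    using smooth_strongly_convex.arg_min_on_minimises[OF ssc[OF that] X(1) X_ne]
    by (auto simp: xs_def constrained_opt_def)
  have x_Suc: "x (t + 1) = closest_point X (x t - \<alpha> *\<^sub>R \<eta> t (x t))" if "1 \<le> t" for t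
    using x_step that \<open>h = indicator_infty X\<close> prox_indicator_infty[OF X X_ne \<alpha>(1)] by simp
  have x_in: "x (t + 1) \<in> X" if "1 \<le> t" for t
    using x_Suc[OF that] closest_point_in_set[OF X(1) X_ne] by simp
  have step: "ebar t \<le> r * e t + \<alpha> * norm (\<epsilon> t)" if t: "1 \<le> t" for t
  proof -
    interpret smooth_strongly_convex "F t" "grad (F t)" \<sigma> L_x
      using t by (rule ssc)
    \<comment> \<open>The minimiser is rewritten as the projection of its own exact gradient step,
      so that two projections are compared.\<close>
    have "ebar t = norm (closest_point X (x t - \<alpha> *\<^sub>R \<eta> t (x t))
        - closest_point X (xs t - \<alpha> *\<^sub>R grad (F t) (xs t)))"
      unfolding ebar_def x_Suc[OF t]
      by (subst minimiser_fixed_point[OF X xs_in xs_min \<alpha>(1)]) (use t in auto)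
    also have "\<dots> \<le> norm ((x t - \<alpha> *\<^sub>R \<eta> t (x t)) - (xs t - \<alpha> *\<^sub>R grad (F t) (xs t)))"
      using closest_point_lipschitz[OF X(2,1) X_ne] by (simp add: dist_norm)
    also have "\<dots> = norm (((x t - \<alpha> *\<^sub>R grad (F t) (x t)) - (xs t - \<alpha> *\<^sub>R grad (F t) (xs t)))
        + \<alpha> *\<^sub>R \<epsilon> t)"
      by (simp add: \<epsilon>_def algebra_simps)
    also have "\<dots> \<le> norm ((x t - \<alpha> *\<^sub>R grad (F t) (x t)) - (xs t - \<alpha> *\<^sub>R grad (F t) (xs t)))
        + \<alpha> * norm (\<epsilon> t)"
      using \<alpha>(1) by (intro order_trans[OF norm_triangle_ineq]) simp
    also have "\<dots> \<le> r * e t + \<alpha> * norm (\<epsilon> t)"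
      using gradient_step_contraction[OF \<alpha>(1)] assms(29) by (simp add: e_def)
    finally show ?thesis .
  qed
  \<comment> \<open>Replacing the old minimiser by the new one costs one summand of
    \<open>V\<close>.\<close>
  have drift: "e (t + 1) \<le> ebar t + norm (xs (t + 1) - xs t)" for t
    using norm_triangle_ineq[of "x (t + 1) - xs t" "xs t - xs (t + 1)"]
    by (simp add: e_def ebar_def norm_minus_commute)
  have regret: "F t y - F t (xs t) \<le> G * norm (y - xs t)" if t: "1 \<le> t" and y: "y \<in> X" for t y
  proof -
    interpret smooth_strongly_convex "F t" "grad (F t)" \<sigma> L_x
      using t by (rule ssc)
    have "F t y - F t (xs t) \<le> grad (F t) y \<bullet> (y - xs t)"
      using first_order_lower_bound[of y "xs t"] by (simp add: inner_diff_right)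
    also have "\<dots> \<le> norm (grad (F t) y) * norm (y - xs t)"
      by (rule norm_cauchy_schwarz)
    also have "\<dots> \<le> G * norm (y - xs t)"
      using G_bound y window[OF t] by (intro mult_right_mono) auto
    finally show ?thesis .
  qed
  \<comment> \<open>The recursion for \<open>e\<close> uses the errors at times 1 to
    \<open>T - 1\<close>, that for \<open>ebar\<close> those at 2 to \<open>T\<close>; this is why
    the two bounds subtract different error terms.\<close>
  have E_last: "E = (\<Sum>t = 1..int T - 1. norm (\<epsilon> t)) + norm (\<epsilon> (int T))"
    and E_first: "E = norm (\<epsilon> 1) + (\<Sum>t = 1..int T - 1. norm (\<epsilon> (t + 1)))"
    unfolding E_def using \<open>0 < T\<close> by (rule sum_int_split_last, rule sum_int_split_first)
  have tracking: "tracking_regret F x xs T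
      \<le> G / (1 - r) * ((e 1 - r * e (int T) - \<alpha> * norm (\<epsilon> (int T))) + \<alpha> * E + V)" if "x 1 \<in> X"
  proof -
    have "x t \<in> X" if "1 \<le> t" for t
      using that x_in[of "t - 1"] \<open>x 1 \<in> X\<close> by (cases "t = 1") auto
    then have "tracking_regret F x xs T \<le> G * (\<Sum>t = 1..int T. e t)"
      unfolding tracking_regret_def e_def sum_distrib_left by (intro sum_mono regret) auto
    also have "\<dots> \<le> G * ((e 1 - r * e (int T)
        + (\<Sum>t = 1..int T - 1. \<alpha> * norm (\<epsilon> t) + norm (xs (t + 1) - xs t))) / (1 - r))"
    proof (intro mult_left_mono sum_le_of_contraction_recursion)
      show "e (t + 1) \<le> r * e t + (\<alpha> * norm (\<epsilon> t) + norm (xs (t + 1) - xs t))" if "1 \<le> t" for t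
        using step[OF that] drift[of t] by linarith
    qed (use r \<open>0 < T\<close> \<open>0 < G\<close> in auto)
    also have "\<dots> = G / (1 - r) * ((e 1 - r * e (int T) - \<alpha> * norm (\<epsilon> (int T))) + \<alpha> * E + V)"
    proof -
      have "(\<Sum>t = 1..int T - 1. \<alpha> * norm (\<epsilon> t) + norm (xs (t + 1) - xs t))
          = \<alpha> * (E - norm (\<epsilon> (int T))) + V"
        by (simp add: E_last V_def sum.distrib sum_distrib_left)
      then show ?thesis
        by (simp add: right_diff_distrib add.assoc)
    qed
    finally show ?thesis .
  qed
  have "estimation_regret F x xs T \<le> G * (\<Sum>t = 1..int T. ebar t)"
    unfolding estimation_regret_def ebar_def sum_distrib_left by (intro sum_mono regret x_in) auto
  also have "\<dots> \<le> G * ((ebar 1 - r * ebar (int T)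
      + (\<Sum>t = 1..int T - 1. \<alpha> * norm (\<epsilon> (t + 1)) + r * norm (xs (t + 1) - xs t))) / (1 - r))"
  proof (intro mult_left_mono sum_le_of_contraction_recursion)
    fix t :: int
    assume t: "1 \<le> t"
    \<comment> \<open>Here the drift precedes the contraction, so it is damped by \<open>r\<close>;
      in the recursion for \<open>e\<close> it follows the contraction.\<close>
    have "r * e (t + 1) \<le> r * (ebar t + norm (xs (t + 1) - xs t))"
      using drift r by (intro mult_left_mono) auto
    then show "ebar (t + 1) \<le> r * ebar t + (\<alpha> * norm (\<epsilon> (t + 1)) + r * norm (xs (t + 1) - xs t))"
      using step[of "t + 1"] t by (simp add: distrib_left)
  qed (use r \<open>0 < T\<close> \<open>0 < G\<close> in auto)
  also have "\<dots> = G / (1 - r) * ((ebar 1 - r * ebar (int T) - \<alpha> * norm (\<epsilon> 1)) + \<alpha> * E + r * V)"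
  proof -
    have "(\<Sum>t = 1..int T - 1. \<alpha> * norm (\<epsilon> (t + 1)) + r * norm (xs (t + 1) - xs t))
        = \<alpha> * (E - norm (\<epsilon> 1)) + r * V"
      by (simp add: E_first V_def sum.distrib sum_distrib_left)
    then show ?thesis
      by (simp add: right_diff_distrib add.assoc)
  qed
  finally show ?thesis
    using tracking by blast
qed

end
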